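(* If $(x_1,x_2,x_3)\neq(0,0,0)$ and $x_i\ge 0$ for $i=1,2,3$, then: (i) $x_1^4+x_2^4+x_3^4+6x_1^2x_2^2+6x_1^2x_3^2+6x_2^2x_3^2+4x_1^3x_3+4x_1x_2^3+4x_1x_3^3+4x_2^3x_3+4x_2x_3^3+4x_1^3x_2>12x_1^2x_2x_3+12x_1x_2^2x_3+12x_1x_2x_3^2$, or equivalently, $(x_1+x_2+x_3)^4>24x_1x_2x_3(x_1+x_2+x_3)$; (ii) $x_1^4+x_2^4+x_3^4+4x_1^3x_3+4x_1x_2^3+4x_1x_3^3+4x_2^3x_3+4x_2x_3^3+4x_1^3x_2+12x_1x_2^2x_3+12x_1x_2x_3^2>6x_1^2x_2^2+6x_1^2x_3^2+6x_2^2x_3^2+12x_1^2x_2x_3$, or equivalently, $(x_1+x_2+x_3)^4>12(x_1^2x_2^2+x_1^2x_3^2+x_2^2x_3^2+2x_1^2x_2x_3)$; (iii) $x_1^4+x_2^4+x_3^4+4x_1^3x_3+4x_1x_2^3+4x_1x_3^3+4x_2^3x_3+4x_2x_3^3+4x_1^3x_2+12x_1x_2^2x_3+12x_1^2x_2x_3>6x_1^2x_2^2+6x_1^2x_3^2+6x_2^2x_3^2+12x_1x_2x_3^2$, or equivalently, $(x_1+x_2+x_3)^4>12(x_1^2x_2^2+x_1^2x_3^2+x_2^2x_3^2+2x_1x_2x_3^2)$; (iv) $x_1^4+x_2^4+x_3^4+4x_1^3x_3+4x_1x_2^3+4x_1x_3^3+4x_2^3x_3+4x_2x_3^3+4x_1^3x_2+12x_1^2x_2x_3+12x_1x_2x_3^2>6x_1^2x_2^2+6x_1^2x_3^2+6x_2^2x_3^2+12x_1x_2^2x_3$,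 or equivalently, $(x_1+x_2+x_3)^4>12(x_1^2x_2^2+x_1^2x_3^2+x_2^2x_3^2+2x_1x_2^2x_3)$; (v) $x_1^4+x_2^4+x_3^4+6x_1^2x_3^2+4x_1^3x_3+4x_1x_2^3+4x_1x_3^3+4x_2^3x_3+4x_2x_3^3+4x_1^3x_2+12x_1x_2^2x_3>6x_1^2x_2^2+6x_2^2x_3^2+12x_1^2x_2x_3+12x_1x_2x_3^2$, or equivalently, $(x_1-x_2+x_3)^4>12(x_1^2x_2^2+x_2^2x_3^2)$; (vi) $x_1^4+x_2^4+x_3^4+6x_2^2x_3^2+4x_1^3x_3+4x_1x_2^3+4x_1x_3^3+4x_2^3x_3+4x_2x_3^3+4x_1^3x_2+12x_1^2x_2x_3>6x_1^2x_3^2+6x_1^2x_2^2+12x_1x_2^2x_3+12x_1x_2x_3^2$, or equivalently, $(x_2-x_1+x_3)^4>12(x_1^2x_3^2+x_2^2x_1^2)$; (vii) $x_1^4+x_2^4+x_3^4+6x_1^2x_2^2+4x_1^3x_3+4x_1x_2^3+4x_1x_3^3+4x_2^3x_3+4x_2x_3^3+4x_1^3x_2+12x_1x_2x_3^2>6x_1^2x_3^2+6x_2^2x_3^2+12x_1x_2^2x_3+12x_1^2x_2x_3$, or equivalently, $(x_1+x_2-x_3)^4>12(x_1^2x_3^2+x_2^2x_3^2)$.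
   Context: Here $x_1,x_2,x_3$ are real numbers.
   Formalization: In (v)–(vii) the printed second form is false (e.g. (v) at (1,1,0) reads 0>12); the formal version subtracts 8 times the sum of the cubic-by-linear terms in the negated variable, e.g. 8(x1^3x2+x1x2^3+x2^3x3+x2x3^3) in (v), on the right. *)

theory Defs
  imports Complex_Main
begin

(* In its last three items the source gives the "equivalent" form of the expanded inequality as
     (x1 - x2 + x3)^4 > 12 (x1^2 x2^2 + x2^2 x3^2)
   and the analogues with x1 or x3 negated instead of x2. It is neither
   equivalent to the expanded inequality nor true, as the following instances show: the expansion of the left-hand side has the terms
   that are odd in the negated variable with a minus sign. The theorem supplies the missing
   terms, here
     (x1 - x2 + x3)^4 > 12 (x1^2 x2^2 + x2^2 x3^2) - 8 (x1^3 x2 + x1 x2^3 + x2^3 x3 + x2 x3^3). *)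

lemma printed_forms_fail:
  fixes x1 x2 x3 :: real
  shows "x1 = 1 \<Longrightarrow> x2 = 1 \<Longrightarrow> x3 = 0 \<Longrightarrow>
           \<not> (x1 - x2 + x3) ^ 4 > 12 * (x1 ^ 2 * x2 ^ 2 + x2 ^ 2 * x3 ^ 2)"
    and "x1 = 1 \<Longrightarrow> x2 = 1 \<Longrightarrow> x3 = 0 \<Longrightarrow>
           \<not> (x2 - x1 + x3) ^ 4 > 12 * (x1 ^ 2 * x3 ^ 2 + x2 ^ 2 * x1 ^ 2)"
    and "x1 = 1 \<Longrightarrow> x2 = 0 \<Longrightarrow> x3 = 1 \<Longrightarrow>
           \<not> (x1 + x2 - x3) ^ 4 > 12 * (x1 ^ 2 * x3 ^ 2 + x2 ^ 2 * x3 ^ 2)"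
  by simp_all

end

theory Submission
  imports Defs
begin

text \<open>
  Every one of the seven inequalities bounds from above, by half of \<open>s\<^sup>4\<close> with
  \<open>s = x1 + x2 + x3\<close>, the sum of those monomials in the multinomial expansion of
  \<open>s\<^sup>4\<close> that stand on the smaller side: twice that sum is subtracted from \<open>s\<^sup>4\<close>, which flips
  the signs of exactly these monomials. Up to permuting the variables only three sets of
  monomials occur, so three inequalities suffice.

  For (i) the subtracted term is \<open>24 a b c s\<close>, and the claim is the inequality of arithmetic and
  geometric means \<open>27 a b c \<le> s\<^sup>3\<close> with room to spare. In the other two, one variable is
  distinguished, and the remaining two enter only through their sum \<open>t\<close> and product \<open>p\<close>, where
  \<open>0 \<le> p \<le> t\<^sup>2 / 4\<close>. For (ii)-(iv) the difference of the two sides is decreasing in \<open>p\<close>, and for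
  (v)-(vii) it is affine in \<open>p\<close>, so it is enough to look at the extreme values of \<open>p\<close>. What
  remains are binary quartic forms that are visibly positive.

  Each equivalence holds because the two inequalities have the same difference of sides, which
  expanding the powers shows.
\<close>

lemma cube_sum_ge_27_mult:
  fixes a b c :: real
  assumes "a \<ge> 0" "b \<ge> 0" "c \<ge> 0"
  shows "27 * a * b * c \<le> (a + b + c) ^ 3"
proof -
  \<comment> \<open>The two sides differ by \<open>a\<^sup>3 + b\<^sup>3 + c\<^sup>3 - 3 a b c\<close>, a nonnegative multiple of
    \<open>(a - b)\<^sup>2 + (b - c)\<^sup>2 + (c - a)\<^sup>2\<close>, and three times the expression
    \<open>a (b - c)\<^sup>2 + b (c - a)\<^sup>2 + c (a - b)\<^sup>2\<close>.\<close>
  have "(a + b + c) ^ 3 - 27 * a * b * c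
      = (a + b + c) * ((a - b)\<^sup>2 + (b - c)\<^sup>2 + (c - a)\<^sup>2) / 2
        + 3 * (a * (b - c)\<^sup>2 + b * (c - a)\<^sup>2 + c * (a - b)\<^sup>2)"
    by (simp add: power2_eq_square power3_eq_cube field_simps)
  moreover have "\<dots> \<ge> 0"
    using assms by simp
  ultimately show ?thesis by linarith
qed

lemma fourth_power_sum_gt_24_mult:
  fixes a b c :: real
  assumes "a \<ge> 0" "b \<ge> 0" "c \<ge> 0" "a + b + c > 0"
  shows "24 * a * b * c * (a + b + c) < (a + b + c) ^ 4"
proof -
  have "24 * (a * b * c) < (a + b + c) ^ 3"
  proof (cases "a * b * c = 0")
    case True
    moreover have "(a + b + c) ^ 3 > 0"
      using assms(4) by (rule zero_less_power)
    ultimately show ?thesis by linarith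
  next
    case False
    then have "a * b * c > 0"
      using assms by (simp add: less_le)
    then show ?thesis
      using cube_sum_ge_27_mult[OF assms(1-3)] by linarith
  qed
  then have "24 * (a * b * c) * (a + b + c) < (a + b + c) ^ 3 * (a + b + c)"
    using assms(4) by (rule mult_strict_right_mono)
  then show ?thesis
    by (simp add: power4_eq_xxxx power3_eq_cube mult.assoc)
qed

text \<open>
  The square \<open>a\<^sup>2 t\<^sup>2\<close> has only the coefficient \<open>6\<close> in \<open>(a + t)\<^sup>4\<close>; the other half of
  \<open>12 a\<^sup>2 t\<^sup>2\<close> is absorbed by \<open>4 a\<^sup>3 t + 4 a t\<^sup>3\<close>. Hence the pure fourth powers can be kept,
  to be played off against the product of the two variables summed up in \<open>t\<close>.
\<close>

lemma fourth_power_sum_ge_12_mult_squares: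
  fixes a t :: real
  assumes "a \<ge> 0" "t \<ge> 0"
  shows "a ^ 4 + t ^ 4 + 12 * a\<^sup>2 * t\<^sup>2 \<le> (a + t) ^ 4"
proof -
  have "(a + t) ^ 4 - (a ^ 4 + t ^ 4 + 12 * a\<^sup>2 * t\<^sup>2)
      = a * t * (3 * (a - t)\<^sup>2 + a\<^sup>2 + t\<^sup>2)"
    by (simp add: power4_eq_xxxx power2_eq_square algebra_simps)
  moreover have "\<dots> \<ge> 0"
    using assms by simp
  ultimately show ?thesis by linarith
qed

text \<open>
  The bracket on the left is \<open>a\<^sup>2 t\<^sup>2 + p\<^sup>2\<close> for \<open>t = b + c\<close> and \<open>p = b c\<close>. Since
  \<open>16 p\<^sup>2 \<le> t\<^sup>4\<close>, the term \<open>12 p\<^sup>2\<close> uses up at most three quarters of \<open>t\<^sup>4\<close>.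
\<close>

lemma fourth_power_sum_gt_12_pair_products:
  fixes a b c :: real
  assumes "a \<ge> 0" "b \<ge> 0" "c \<ge> 0" "a + b + c > 0"
  shows "12 * (a\<^sup>2 * b\<^sup>2 + a\<^sup>2 * c\<^sup>2 + b\<^sup>2 * c\<^sup>2 + 2 * a\<^sup>2 * b * c) < (a + b + c) ^ 4"
proof -
  define t where "t = b + c"
  have t: "t \<ge> 0" "a > 0 \<or> t > 0"
    using assms by (auto simp: t_def)
  have "4 * (b * c) \<le> t\<^sup>2"
    using sum_squares_bound[of b c] by (simp add: t_def power2_eq_square algebra_simps)
  then have "(4 * (b * c))\<^sup>2 \<le> (t\<^sup>2)\<^sup>2"
    using assms by (intro power_mono) auto
  then have "16 * (b * c)\<^sup>2 \<le> t ^ 4"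
    by (simp add: power_mult_distrib)
  moreover have "a ^ 4 > 0 \<or> t ^ 4 > 0" "a ^ 4 \<ge> 0" "t ^ 4 \<ge> 0"
    using t by auto
  ultimately have "12 * a\<^sup>2 * t\<^sup>2 + 12 * (b * c)\<^sup>2 < (a + t) ^ 4"
    using fourth_power_sum_ge_12_mult_squares[OF assms(1) t(1)] by linarith
  then show ?thesis
    by (simp add: t_def power2_eq_square algebra_simps)
qed

text \<open>
  In terms of \<open>t = a + c\<close> and \<open>p = a c\<close> the left-hand side is
  \<open>12 b\<^sup>2 t\<^sup>2 + 24 p b (t - b)\<close>. Depending on the sign of \<open>t - b\<close>, its maximum over
  \<open>0 \<le> p \<le> t\<^sup>2 / 4\<close> is attained at one end or the other.
\<close>

lemma fourth_power_sum_gt_12_odd_products: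
  fixes a b c :: real
  assumes "a \<ge> 0" "b \<ge> 0" "c \<ge> 0" "a + b + c > 0"
  shows "12 * (b\<^sup>2 * (a\<^sup>2 + c\<^sup>2) + 2 * a * b * c * (a + c)) < (a + b + c) ^ 4"
proof -
  define t where "t = a + c"
  define p where "p = a * c"
  have t: "t \<ge> 0" "b > 0 \<or> t > 0"
    using assms by (auto simp: t_def)
  have p: "0 \<le> p" "4 * p \<le> t\<^sup>2"
    using assms sum_squares_bound[of a c]
    by (simp_all add: p_def t_def power2_eq_square algebra_simps)
  have "12 * b\<^sup>2 * t\<^sup>2 + 24 * p * (b * (t - b)) < (b + t) ^ 4"
  proof (cases "t \<ge> b")
    case True
    \<comment> \<open>The product \<open>p\<close> is replaced by \<open>t\<^sup>2 / 4\<close>. The resulting form is positive because \<open>b t = 0\<close>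
      and \<open>t\<^sup>2 - b t - b\<^sup>2 = 0\<close> together force \<open>b = t = 0\<close>.\<close>
    have "4 * p * (b * (t - b)) \<le> t\<^sup>2 * (b * (t - b))"
      using p(2) by (rule mult_right_mono) (use True assms in simp)
    moreover have "(b + t) ^ 4 - 12 * b\<^sup>2 * t\<^sup>2 - 6 * (t\<^sup>2 * (b * (t - b)))
        = (t\<^sup>2 - b * t - b\<^sup>2)\<^sup>2 + (b * t)\<^sup>2 + 2 * b ^ 3 * t"
      by (simp add: power4_eq_xxxx power3_eq_cube power2_eq_square algebra_simps)
    moreover have "(t\<^sup>2 - b * t - b\<^sup>2)\<^sup>2 + (b * t)\<^sup>2 > 0"
      using t by (auto simp: sum_power2_gt_zero_iff)
    moreover have "2 * b ^ 3 * t \<ge> 0"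
      using assms(2) t(1) by simp
    ultimately show ?thesis by linarith
  next
    case False
    then have "b * (t - b) \<le> 0" "b ^ 4 > 0" "t ^ 4 \<ge> 0"
      using assms(2) t(1) by (simp_all add: mult_nonneg_nonpos)
    moreover from this have "p * (b * (t - b)) \<le> 0"
      using p(1) by (simp add: mult_nonneg_nonpos)
    ultimately show ?thesis
      using fourth_power_sum_ge_12_mult_squares[OF assms(2) t(1)] by linarith
  qed
  then show ?thesis
    by (simp add: t_def p_def power2_eq_square algebra_simps)
qed

theorem theorem3p12:
  fixes x1 x2 x3 :: real
  assumes "(x1, x2, x3) \<noteq> (0, 0, 0)" and "x1 \<ge> 0" and "x2 \<ge> 0" and "x3 \<ge> 0"
  shows
    "((x1 ^ 4 + x2 ^ 4 + x3 ^ 4 + 6 * x1 ^ 2 * x2 ^ 2 + 6 * x1 ^ 2 * x3 ^ 2 + 6 * x2 ^ 2 * x3 ^ 2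
         + 4 * x1 ^ 3 * x3 + 4 * x1 * x2 ^ 3 + 4 * x1 * x3 ^ 3 + 4 * x2 ^ 3 * x3 + 4 * x2 * x3 ^ 3 + 4 * x1 ^ 3 * x2
       > 12 * x1 ^ 2 * x2 * x3 + 12 * x1 * x2 ^ 2 * x3 + 12 * x1 * x2 * x3 ^ 2)
     \<and> ((x1 ^ 4 + x2 ^ 4 + x3 ^ 4 + 6 * x1 ^ 2 * x2 ^ 2 + 6 * x1 ^ 2 * x3 ^ 2 + 6 * x2 ^ 2 * x3 ^ 2
         + 4 * x1 ^ 3 * x3 + 4 * x1 * x2 ^ 3 + 4 * x1 * x3 ^ 3 + 4 * x2 ^ 3 * x3 + 4 * x2 * x3 ^ 3 + 4 * x1 ^ 3 * x2
       > 12 * x1 ^ 2 * x2 * x3 + 12 * x1 * x2 ^ 2 * x3 + 12 * x1 * x2 * x3 ^ 2)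
        \<longleftrightarrow> (x1 + x2 + x3) ^ 4 > 24 * x1 * x2 * x3 * (x1 + x2 + x3)))
     \<and>
     ((x1 ^ 4 + x2 ^ 4 + x3 ^ 4 + 4 * x1 ^ 3 * x3 + 4 * x1 * x2 ^ 3 + 4 * x1 * x3 ^ 3
         + 4 * x2 ^ 3 * x3 + 4 * x2 * x3 ^ 3 + 4 * x1 ^ 3 * x2 + 12 * x1 * x2 ^ 2 * x3 + 12 * x1 * x2 * x3 ^ 2
       > 6 * x1 ^ 2 * x2 ^ 2 + 6 * x1 ^ 2 * x3 ^ 2 + 6 * x2 ^ 2 * x3 ^ 2 + 12 * x1 ^ 2 * x2 * x3)
     \<and> ((x1 ^ 4 + x2 ^ 4 + x3 ^ 4 + 4 * x1 ^ 3 * x3 + 4 * x1 * x2 ^ 3 + 4 * x1 * x3 ^ 3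
         + 4 * x2 ^ 3 * x3 + 4 * x2 * x3 ^ 3 + 4 * x1 ^ 3 * x2 + 12 * x1 * x2 ^ 2 * x3 + 12 * x1 * x2 * x3 ^ 2
       > 6 * x1 ^ 2 * x2 ^ 2 + 6 * x1 ^ 2 * x3 ^ 2 + 6 * x2 ^ 2 * x3 ^ 2 + 12 * x1 ^ 2 * x2 * x3)
        \<longleftrightarrow> (x1 + x2 + x3) ^ 4 > 12 * (x1 ^ 2 * x2 ^ 2 + x1 ^ 2 * x3 ^ 2 + x2 ^ 2 * x3 ^ 2 + 2 * x1 ^ 2 * x2 * x3)))
     \<and>
     ((x1 ^ 4 + x2 ^ 4 + x3 ^ 4 + 4 * x1 ^ 3 * x3 + 4 * x1 * x2 ^ 3 + 4 * x1 * x3 ^ 3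
         + 4 * x2 ^ 3 * x3 + 4 * x2 * x3 ^ 3 + 4 * x1 ^ 3 * x2 + 12 * x1 * x2 ^ 2 * x3 + 12 * x1 ^ 2 * x2 * x3
       > 6 * x1 ^ 2 * x2 ^ 2 + 6 * x1 ^ 2 * x3 ^ 2 + 6 * x2 ^ 2 * x3 ^ 2 + 12 * x1 * x2 * x3 ^ 2)
     \<and> ((x1 ^ 4 + x2 ^ 4 + x3 ^ 4 + 4 * x1 ^ 3 * x3 + 4 * x1 * x2 ^ 3 + 4 * x1 * x3 ^ 3
         + 4 * x2 ^ 3 * x3 + 4 * x2 * x3 ^ 3 + 4 * x1 ^ 3 * x2 + 12 * x1 * x2 ^ 2 * x3 + 12 * x1 ^ 2 * x2 * x3
       > 6 * x1 ^ 2 * x2 ^ 2 + 6 * x1 ^ 2 * x3 ^ 2 + 6 * x2 ^ 2 * x3 ^ 2 + 12 * x1 * x2 * x3 ^ 2)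
        \<longleftrightarrow> (x1 + x2 + x3) ^ 4 > 12 * (x1 ^ 2 * x2 ^ 2 + x1 ^ 2 * x3 ^ 2 + x2 ^ 2 * x3 ^ 2 + 2 * x1 * x2 * x3 ^ 2)))
     \<and>
     ((x1 ^ 4 + x2 ^ 4 + x3 ^ 4 + 4 * x1 ^ 3 * x3 + 4 * x1 * x2 ^ 3 + 4 * x1 * x3 ^ 3
         + 4 * x2 ^ 3 * x3 + 4 * x2 * x3 ^ 3 + 4 * x1 ^ 3 * x2 + 12 * x1 ^ 2 * x2 * x3 + 12 * x1 * x2 * x3 ^ 2
       > 6 * x1 ^ 2 * x2 ^ 2 + 6 * x1 ^ 2 * x3 ^ 2 + 6 * x2 ^ 2 * x3 ^ 2 + 12 * x1 * x2 ^ 2 * x3)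
     \<and> ((x1 ^ 4 + x2 ^ 4 + x3 ^ 4 + 4 * x1 ^ 3 * x3 + 4 * x1 * x2 ^ 3 + 4 * x1 * x3 ^ 3
         + 4 * x2 ^ 3 * x3 + 4 * x2 * x3 ^ 3 + 4 * x1 ^ 3 * x2 + 12 * x1 ^ 2 * x2 * x3 + 12 * x1 * x2 * x3 ^ 2
       > 6 * x1 ^ 2 * x2 ^ 2 + 6 * x1 ^ 2 * x3 ^ 2 + 6 * x2 ^ 2 * x3 ^ 2 + 12 * x1 * x2 ^ 2 * x3)
        \<longleftrightarrow> (x1 + x2 + x3) ^ 4 > 12 * (x1 ^ 2 * x2 ^ 2 + x1 ^ 2 * x3 ^ 2 + x2 ^ 2 * x3 ^ 2 + 2 * x1 * x2 ^ 2 * x3)))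
     \<and>
     ((x1 ^ 4 + x2 ^ 4 + x3 ^ 4 + 6 * x1 ^ 2 * x3 ^ 2 + 4 * x1 ^ 3 * x3 + 4 * x1 * x2 ^ 3
         + 4 * x1 * x3 ^ 3 + 4 * x2 ^ 3 * x3 + 4 * x2 * x3 ^ 3 + 4 * x1 ^ 3 * x2 + 12 * x1 * x2 ^ 2 * x3
       > 6 * x1 ^ 2 * x2 ^ 2 + 6 * x2 ^ 2 * x3 ^ 2 + 12 * x1 ^ 2 * x2 * x3 + 12 * x1 * x2 * x3 ^ 2)
     \<and> ((x1 ^ 4 + x2 ^ 4 + x3 ^ 4 + 6 * x1 ^ 2 * x3 ^ 2 + 4 * x1 ^ 3 * x3 + 4 * x1 * x2 ^ 3
         + 4 * x1 * x3 ^ 3 + 4 * x2 ^ 3 * x3 + 4 * x2 * x3 ^ 3 + 4 * x1 ^ 3 * x2 + 12 * x1 * x2 ^ 2 * x3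
       > 6 * x1 ^ 2 * x2 ^ 2 + 6 * x2 ^ 2 * x3 ^ 2 + 12 * x1 ^ 2 * x2 * x3 + 12 * x1 * x2 * x3 ^ 2)
        \<longleftrightarrow> (x1 - x2 + x3) ^ 4 > 12 * (x1 ^ 2 * x2 ^ 2 + x2 ^ 2 * x3 ^ 2) - 8 * (x1 ^ 3 * x2 + x1 * x2 ^ 3 + x2 ^ 3 * x3 + x2 * x3 ^ 3)))
     \<and>
     ((x1 ^ 4 + x2 ^ 4 + x3 ^ 4 + 6 * x2 ^ 2 * x3 ^ 2 + 4 * x1 ^ 3 * x3 + 4 * x1 * x2 ^ 3
         + 4 * x1 * x3 ^ 3 + 4 * x2 ^ 3 * x3 + 4 * x2 * x3 ^ 3 + 4 * x1 ^ 3 * x2 + 12 * x1 ^ 2 * x2 * x3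
       > 6 * x1 ^ 2 * x3 ^ 2 + 6 * x1 ^ 2 * x2 ^ 2 + 12 * x1 * x2 ^ 2 * x3 + 12 * x1 * x2 * x3 ^ 2)
     \<and> ((x1 ^ 4 + x2 ^ 4 + x3 ^ 4 + 6 * x2 ^ 2 * x3 ^ 2 + 4 * x1 ^ 3 * x3 + 4 * x1 * x2 ^ 3
         + 4 * x1 * x3 ^ 3 + 4 * x2 ^ 3 * x3 + 4 * x2 * x3 ^ 3 + 4 * x1 ^ 3 * x2 + 12 * x1 ^ 2 * x2 * x3
       > 6 * x1 ^ 2 * x3 ^ 2 + 6 * x1 ^ 2 * x2 ^ 2 + 12 * x1 * x2 ^ 2 * x3 + 12 * x1 * x2 * x3 ^ 2)
        \<longleftrightarrow> (x2 - x1 + x3) ^ 4 > 12 * (x1 ^ 2 * x3 ^ 2 + x2 ^ 2 * x1 ^ 2) - 8 * (x1 ^ 3 * x2 + x1 * x2 ^ 3 + x1 ^ 3 * x3 + x1 * x3 ^ 3)))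
     \<and>
     ((x1 ^ 4 + x2 ^ 4 + x3 ^ 4 + 6 * x1 ^ 2 * x2 ^ 2 + 4 * x1 ^ 3 * x3 + 4 * x1 * x2 ^ 3
         + 4 * x1 * x3 ^ 3 + 4 * x2 ^ 3 * x3 + 4 * x2 * x3 ^ 3 + 4 * x1 ^ 3 * x2 + 12 * x1 * x2 * x3 ^ 2
       > 6 * x1 ^ 2 * x3 ^ 2 + 6 * x2 ^ 2 * x3 ^ 2 + 12 * x1 * x2 ^ 2 * x3 + 12 * x1 ^ 2 * x2 * x3)
     \<and> ((x1 ^ 4 + x2 ^ 4 + x3 ^ 4 + 6 * x1 ^ 2 * x2 ^ 2 + 4 * x1 ^ 3 * x3 + 4 * x1 * x2 ^ 3
         + 4 * x1 * x3 ^ 3 + 4 * x2 ^ 3 * x3 + 4 * x2 * x3 ^ 3 + 4 * x1 ^ 3 * x2 + 12 * x1 * x2 * x3 ^ 2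
       > 6 * x1 ^ 2 * x3 ^ 2 + 6 * x2 ^ 2 * x3 ^ 2 + 12 * x1 * x2 ^ 2 * x3 + 12 * x1 ^ 2 * x2 * x3)
        \<longleftrightarrow> (x1 + x2 - x3) ^ 4 > 12 * (x1 ^ 2 * x3 ^ 2 + x2 ^ 2 * x3 ^ 2) - 8 * (x1 ^ 3 * x3 + x1 * x3 ^ 3 + x2 ^ 3 * x3 + x2 * x3 ^ 3)))"
proof -
  have pos: "x1 + x2 + x3 > 0" "x2 + x1 + x3 > 0" "x3 + x1 + x2 > 0" "x1 + x3 + x2 > 0"
    using assms by auto
  note monomials = power4_eq_xxxx power3_eq_cube power2_eq_square algebra_simps
  note one = fourth_power_sum_gt_24_mult[OF assms(2-4) pos(1)]
  note two = fourth_power_sum_gt_12_pair_products[OF assms(2-4) pos(1)]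
    and three = fourth_power_sum_gt_12_pair_products[OF assms(4,2,3) pos(3)]
    and four = fourth_power_sum_gt_12_pair_products[OF assms(3,2,4) pos(2)]
  note five = fourth_power_sum_gt_12_odd_products[OF assms(2-4) pos(1)]
    and six = fourth_power_sum_gt_12_odd_products[OF assms(3,2,4) pos(2)]
    and seven = fourth_power_sum_gt_12_odd_products[OF assms(2,4,3) pos(4)]
  show ?thesis
    apply (intro conjI)
    subgoal using one by (simp add: monomials)
    subgoal by (simp add: monomials)
    subgoal using two by (simp add: monomials)
    subgoal by (simp add: monomials)
    subgoal using three by (simp add: monomials)
    subgoal by (simp add: monomials)
    subgoal using four by (simp add: monomials)
    subgoal by (simp add: monomials)
    subgoal using five by (simp add: monomials)
    subgoal by (simp add: monomials)
    subgoal using six by (simp add: monomials)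
    subgoal by (simp add: monomials)
    subgoal using seven by (simp add: monomials)
    subgoal by (simp add: monomials)
    done
qed

end
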